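(* Let $k\in\mathbb{N}$. If $k\ge 5$, then every $4$-dimensional grid is equitably $k$-list arborable.
   Context: $P_n$ denotes the path on $n$ vertices and $\square$ the Cartesian product. A $4$-dimensional grid is $P_{n_1}\square P_{n_2}\square P_{n_3}\square P_{n_4}$ with every $n_i\ge 2$. A $k$-uniform list assignment $L$ for $G$ assigns to each vertex $v$ a set $L(v)$ of exactly $k$ colours; an $L$-colouring is a map $c$ with $c(v)\in L(v)$; it is equitable if every colour class has at most $\lceil |V(G)|/k\rceil$ vertices. $G$ is equitably $k$-list arborable if for every $k$-uniform list assignment $L$ there is an equitable $L$-colouring of $G$ in which every colour class induces an acyclic subgraph. *)

theory Defs
  imports Complex_Main "Graph_Theory.Digraph_Component"
begin

text \<open>
  Finite simple graphs are represented as in the locale \<^locale>\<open>pair_graph\<close>: an undirected edge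
  is a pair of opposite arcs.
\<close>

definition path_graph :: "nat \<Rightarrow> nat pair_pre_digraph" where
  "path_graph n = \<lparr> pverts = {..<n}, parcs = {(i, j). i < n \<and> j < n \<and> (j = Suc i \<or> i = Suc j)} \<rparr>"

definition cartesian_product ::
  "'a pair_pre_digraph \<Rightarrow> 'b pair_pre_digraph \<Rightarrow> ('a \<times> 'b) pair_pre_digraph" (infixr \<open>\<box>\<close> 70)
where
  "G \<box> H =
    \<lparr> pverts = pverts G \<times> pverts H,
      parcs = {((u, v), (u', v')).
        (u, u') \<in> parcs G \<and> v = v' \<and> v \<in> pverts H \<or>
        u = u' \<and> u \<in> pverts G \<and> (v, v') \<in> parcs H} \<rparr>"

lemma pair_graph_path_graph: "pair_graph (path_graph n)"
proof unfold_locales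
  show "finite (parcs (path_graph n))"
    by (rule finite_subset[of _ "{..<n} \<times> {..<n}"]) (auto simp: path_graph_def)
  show "symmetric (with_proj (path_graph n))"
    by (auto simp: symmetric_def sym_def path_graph_def)
qed (auto simp: path_graph_def)

lemma pair_graph_cartesian_product:
  assumes "pair_graph G" "pair_graph H"
  shows "pair_graph (G \<box> H)"
proof -
  interpret G: pair_graph G by fact
  interpret H: pair_graph H by fact
  show ?thesis
  proof unfold_locales
    show "finite (pverts (G \<box> H))"
      by (simp add: cartesian_product_def)
    show "finite (parcs (G \<box> H))"
      by (rule finite_subset[of _ "(pverts G \<times> pverts H) \<times> (pverts G \<times> pverts H)"])
        (auto simp: cartesian_product_def dest: G.wellformed' H.wellformed')
    show "symmetric (with_proj (G \<box> H))"
      using G.arcs_symmetric H.arcs_symmetric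
      by (auto simp: symmetric_def sym_def cartesian_product_def)
  qed (auto simp: cartesian_product_def
        dest: G.wellformed' H.wellformed' G.no_loops' H.no_loops')
qed

text \<open>
  The library's \<^const>\<open>forest\<close> does not fit undirected graphs: in a symmetric digraph every
  edge gives a directed cycle of length 2. The (undirected) cycles of a simple graph are exactly
  the directed cycles of length at least 3 of its symmetric digraph.
\<close>

definition acyclic_graph :: "('a, 'a \<times> 'a) pre_digraph \<Rightarrow> bool" where
  "acyclic_graph G \<longleftrightarrow> \<not> (\<exists>p. pre_digraph.cycle G p \<and> 3 \<le> length p)"

definition uniform_list_assignment :: "'a pair_pre_digraph \<Rightarrow> nat \<Rightarrow> ('a \<Rightarrow> 'c set) \<Rightarrow> bool" where
  "uniform_list_assignment G k L \<longleftrightarrow> (\<forall>v \<in> pverts G. finite (L v) \<and> card (L v) = k)"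

definition list_colouring :: "'a pair_pre_digraph \<Rightarrow> ('a \<Rightarrow> 'c set) \<Rightarrow> ('a \<Rightarrow> 'c) \<Rightarrow> bool" where
  "list_colouring G L c \<longleftrightarrow> (\<forall>v \<in> pverts G. c v \<in> L v)"

definition colour_class :: "'a pair_pre_digraph \<Rightarrow> ('a \<Rightarrow> 'c) \<Rightarrow> 'c \<Rightarrow> 'a set" where
  "colour_class G c a = {v \<in> pverts G. c v = a}"

definition equitable :: "'a pair_pre_digraph \<Rightarrow> nat \<Rightarrow> ('a \<Rightarrow> 'c) \<Rightarrow> bool" where
  "equitable G k c \<longleftrightarrow>
    (\<forall>a. int (card (colour_class G c a)) \<le> \<lceil>real (card (pverts G)) / real k\<rceil>)"

text \<open>
  The type argument is the type from which the colours are drawn; a result about every list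
  assignment is stated with a type variable in its place.
\<close>

definition equitably_list_arborable ::
  "'c itself \<Rightarrow> nat \<Rightarrow> 'a pair_pre_digraph \<Rightarrow> bool"
where
  "equitably_list_arborable (_ :: 'c itself) k G \<longleftrightarrow>
    (\<forall>L :: 'a \<Rightarrow> 'c set. uniform_list_assignment G k L \<longrightarrow>
      (\<exists>c. list_colouring G L c \<and> equitable G k c \<and>
        (\<forall>a. acyclic_graph (with_proj G \<restriction> colour_class G c a))))"

end

theory Submission
  imports Defs
begin

text \<open>
  Colour the graph in rounds of \<open>k\<close> vertices \<open>x\<^sub>1, \<dots>, x\<^sub>k\<close> receiving pairwise distinct colours. If
  \<open>x\<^sub>i\<close> has at most \<open>2i - 1\<close> neighbours coloured in earlier rounds, then at most \<open>i - 1\<close> colours occur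
  twice among them, so colouring \<open>x\<^sub>k, \<dots>, x\<^sub>1\<close> greedily gives every new vertex at most one neighbour
  in its class, and the classes remain forests. It remains to see that every set \<open>H\<close> of at least
  \<open>k\<close> grid points contains such \<open>x\<^sub>1, \<dots>, x\<^sub>k\<close> with respect to the rest of \<open>H\<close>. All degrees are at
  most \<open>8\<close>, so only the first four matter. They are found near a minimiser \<open>x\<close> of the weight
  \<open>4a + 3b + 2c + d\<close> on \<open>H\<close>: all neighbours of \<open>x\<close> in \<open>H\<close> lie above \<open>x\<close>, and the two cheapest of
  them have few neighbours in \<open>H\<close> themselves.
\<close>

section \<open>Forests\<close>

definition nbrs :: "'a pair_pre_digraph \<Rightarrow> 'a \<Rightarrow> 'a set" where
  "nbrs G v = {w. (v, w) \<in> parcs G}"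

text \<open>For finite \<open>C\<close> this describes forests as the 1-degenerate graphs. The form
  serves two purposes: it survives adding a vertex with at most one neighbour, and the vertex set of
  a cycle violates it.\<close>

definition forest_on :: "('a \<Rightarrow> 'a set) \<Rightarrow> 'a set \<Rightarrow> bool" where
  "forest_on N C \<longleftrightarrow> (\<forall>Z\<subseteq>C. Z \<noteq> {} \<longrightarrow> (\<exists>v\<in>Z. card (N v \<inter> Z) \<le> 1))"

lemma forest_on_empty: "forest_on N {}"
  by (simp add: forest_on_def)

lemma forest_on_insert:
  assumes "forest_on N C" "finite C" "s \<notin> N s" "card (N s \<inter> C) \<le> 1"
  shows "forest_on N (insert s C)"
  unfolding forest_on_def
proof (intro allI impI)
  fix Z assume Z: "Z \<subseteq> insert s C" "Z \<noteq> {}"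
  show "\<exists>v\<in>Z. card (N v \<inter> Z) \<le> 1"
  proof (cases "s \<in> Z")
    case True
    have "N s \<inter> Z \<subseteq> N s \<inter> C" using Z(1) assms(3) by auto
    then have "card (N s \<inter> Z) \<le> card (N s \<inter> C)" using assms(2) by (intro card_mono) auto
    then show ?thesis using True assms(4) by (intro bexI[of _ s]) auto
  next
    case False
    then have "Z \<subseteq> C" using Z(1) by auto
    then show ?thesis using assms(1) Z(2) by (simp add: forest_on_def)
  qed
qed

section \<open>Forests contain no cycles\<close>

lemma cas_nth:
  assumes "pre_digraph.cas G u p v" "i < length p"
  shows "tail G (p ! i) = (if i = 0 then u else head G (p ! (i - 1)))"
  using assms
proof (induction p arbitrary: u i)
  case Nil
  then show ?case by simp
next
  case (Cons e p)
  show ?case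
  proof (cases i)
    case 0
    then show ?thesis using Cons.prems by (simp add: pre_digraph.cas.simps)
  next
    case (Suc j)
    then show ?thesis using Cons.prems Cons.IH[of "head G e" j]
      by (cases j) (simp_all add: pre_digraph.cas.simps)
  qed
qed

lemma cas_last:
  assumes "pre_digraph.cas G u p v" "p \<noteq> []"
  shows "head G (last p) = v"
  using assms by (induction p arbitrary: u) (auto simp: pre_digraph.cas.simps split: if_splits)

text \<open>On the vertex set of a cycle every vertex has its predecessor and its successor as
  neighbours, and these differ because the length is at least three.\<close>

lemma acyclic_graph_if_forest_on:
  fixes G :: "'a pair_pre_digraph"
  assumes G: "pair_graph G" and forest: "forest_on (nbrs G) C"
  shows "acyclic_graph (with_proj G \<restriction> C)"
  unfolding acyclic_graph_def
proof (rule notI, elim exE conjE)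
  fix p assume cyc: "pre_digraph.cycle (with_proj G \<restriction> C) p" and len: "3 \<le> length p"
  interpret pair_graph G by fact
  let ?m = "length p"
  from cyc obtain u where u: "set p \<subseteq> arcs (with_proj G \<restriction> C)"
      "pre_digraph.cas (with_proj G \<restriction> C) u p u"
      "distinct (tl (pre_digraph.awalk_verts (with_proj G \<restriction> C) u p))"
    unfolding pre_digraph.cycle_def pre_digraph.awalk_def by blast
  have "p \<noteq> []" using len by auto
  then have dist: "distinct (map snd p)"
    using u(3) by (simp add: pre_digraph.awalk_verts_conv'[OF u(2)])
  have arcs: "(fst (p ! i), snd (p ! i)) \<in> parcs G \<and> snd (p ! i) \<in> C" if "i < ?m" for i
    using u(1) nth_mem[OF that] by auto
  have chain: "fst (p ! (Suc i mod ?m)) = snd (p ! i)" if i: "i < ?m" for i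
  proof (cases "Suc i < ?m")
    case True
    then show ?thesis using cas_nth[OF u(2), of "Suc i"] by simp
  next
    case False
    then have "Suc i = ?m" using i by simp
    moreover have "fst (p ! 0) = u" using cas_nth[OF u(2), of 0] \<open>p \<noteq> []\<close> by simp
    moreover have "snd (last p) = u" using cas_last[OF u(2)] \<open>p \<noteq> []\<close> by simp
    ultimately show ?thesis using \<open>p \<noteq> []\<close>
      by (metis diff_Suc_1 last_conv_nth mod_self)
  qed
  define Z where "Z = set (map snd p)"
  have "Z \<subseteq> C" using u(1) by (auto simp: Z_def)
  moreover have "Z \<noteq> {}" using \<open>p \<noteq> []\<close> by (simp add: Z_def)
  ultimately obtain v where v: "v \<in> Z" "card (nbrs G v \<inter> Z) \<le> 1"
    using forest by (auto simp: forest_on_def)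
  then obtain i0 where i0: "i0 < ?m" "v = snd (p ! i0)"
    by (auto simp: Z_def in_set_conv_nth)
  \<comment> \<open>The arc \<open>p ! i0\<close> enters \<open>v\<close>; the arc at
    \<open>?i\<close> precedes it cyclically and the arc at \<open>?j\<close> leaves
    \<open>v\<close>. Adding \<open>?m - 1\<close> steps back by one even when
    \<open>i0 = 0\<close>.\<close>
  let ?i = "(i0 + (?m - 1)) mod ?m" and ?j = "Suc i0 mod ?m"
  have bnd: "?i < ?m" "?j < ?m" using \<open>p \<noteq> []\<close> by simp_all
  have "Suc ?i mod ?m = Suc (i0 + (?m - 1)) mod ?m" by (simp add: mod_Suc_eq)
  also have "Suc (i0 + (?m - 1)) = i0 + ?m" using len by simp
  also have "\<dots> mod ?m = i0" using i0 by simp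
  finally have pred: "fst (p ! i0) = snd (p ! ?i)" using chain[OF bnd(1)] by simp
  have succ: "fst (p ! ?j) = v" using chain[OF i0(1)] i0(2) by simp
  have "?i \<noteq> ?j"
  proof -
    have "?i = (if i0 = 0 then ?m - 1 else i0 - 1)"
    proof (cases i0)
      case (Suc n)
      then have "i0 + (?m - 1) = n + ?m" using len by simp
      then show ?thesis using Suc i0(1) by simp
    qed (use len in simp)
    moreover have "?j = (if Suc i0 = ?m then 0 else Suc i0)" using i0(1) by auto
    ultimately show ?thesis using len i0(1) by (auto split: if_splits)
  qed
  then have ne: "snd (p ! ?i) \<noteq> snd (p ! ?j)"
    using dist bnd nth_eq_iff_index_eq[OF dist, of ?i ?j] by simp
  have "(v, snd (p ! ?i)) \<in> parcs G"
    using arcs[OF i0(1)] arcs_symmetric pred i0(2) by auto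
  moreover have "(v, snd (p ! ?j)) \<in> parcs G"
    using arcs[OF bnd(2)] succ by simp
  moreover have "snd (p ! ?i) \<in> Z" "snd (p ! ?j) \<in> Z" using bnd by (auto simp: Z_def)
  ultimately have "{snd (p ! ?i), snd (p ! ?j)} \<subseteq> nbrs G v \<inter> Z" by (auto simp: nbrs_def)
  moreover have "finite (nbrs G v \<inter> Z)" by (simp add: Z_def)
  ultimately have "card {snd (p ! ?i), snd (p ! ?j)} \<le> 1"
    using v(2) card_mono le_trans by blast
  then show False using ne by simp
qed

section \<open>Colouring in rounds\<close>

text \<open>Values are chosen from the back of the list: when position \<open>i\<close> is reached,
  at most \<open>length xs - i - 1\<close> values are taken, fewer than \<open>A (xs ! i)\<close>
  offers.\<close>

lemma greedy_transversal:
  assumes "distinct xs" "\<And>i. i < length xs \<Longrightarrow> length xs \<le> card (A (xs ! i)) + i"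
  shows "\<exists>f. inj_on f (set xs) \<and> (\<forall>x\<in>set xs. f x \<in> A x)"
  using assms
proof (induction xs)
  case Nil
  then show ?case by simp
next
  case (Cons x xs)
  have "length xs \<le> card (A (xs ! i)) + i" if "i < length xs" for i
    using Cons.prems(2)[of "Suc i"] that by simp
  then obtain f where f: "inj_on f (set xs)" "\<forall>y\<in>set xs. f y \<in> A y"
    using Cons by auto
  have "card (f ` set xs) < card (A x)"
    using Cons.prems(2)[of 0] card_image_le[of "set xs" f] card_length[of xs] by simp
  then have "\<not> A x \<subseteq> f ` set xs"
    using card_mono[of "f ` set xs" "A x"] by auto
  then obtain a where a: "a \<in> A x" "a \<notin> f ` set xs" by auto
  have "x \<notin> set xs" using Cons.prems(1) by simp
  then have "inj_on (f(x := a)) (set (x # xs)) \<and> (\<forall>y\<in>set (x # xs). (f(x := a)) y \<in> A y)"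
    using f a by (auto simp: inj_on_def)
  then show ?case by blast
qed

text \<open>Distinct colours have disjoint classes, and each colour in \<open>B\<close> claims at
  least two elements of \<open>M\<close>.\<close>

lemma card_repeated_colours:
  assumes "finite M" "finite B" "\<And>a. a \<in> B \<Longrightarrow> 2 \<le> card {v \<in> M. c v = a}"
  shows "2 * card B \<le> card M"
proof -
  have "2 * card B = (\<Sum>a\<in>B. 2)" by simp
  also have "\<dots> \<le> (\<Sum>a\<in>B. card {v \<in> M. c v = a})" using assms(3) by (intro sum_mono) auto
  also have "\<dots> = card (\<Union>a\<in>B. {v \<in> M. c v = a})"
    using assms(1,2) by (intro card_UN_disjoint[symmetric]) auto
  also have "\<dots> \<le> card M" using assms(1) by (intro card_mono) auto
  finally show ?thesis .
qed

text \<open>Position \<open>i\<close> of the list \<open>xs\<close> counts from \<open>0\<close>, so the bound \<open>2i - 1\<close> becomes \<open>2i + 1\<close>.\<close>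

lemma equitable_forest_colouring:
  fixes L :: "'a \<Rightarrow> 'c set"
  assumes "finite H" "k > 0"
    and irrefl: "\<And>v. v \<notin> N v"
    and L: "\<And>v. v \<in> H \<Longrightarrow> finite (L v) \<and> card (L v) = k"
    and rounds: "\<And>U. U \<subseteq> H \<Longrightarrow> k \<le> card U \<Longrightarrow>
      \<exists>xs. distinct xs \<and> length xs = k \<and> set xs \<subseteq> U \<and>
        (\<forall>i<k. card (N (xs ! i) \<inter> (U - set xs)) \<le> 2 * i + 1)"
  shows "\<exists>c. (\<forall>v\<in>H. c v \<in> L v) \<and>
    (\<forall>a. forest_on N {v \<in> H. c v = a} \<and>
      int (card {v \<in> H. c v = a}) \<le> \<lceil>real (card H) / real k\<rceil>)"
  using assms(1) L rounds
proof (induction "card H" arbitrary: H rule: less_induct)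
  case less
  note fin = less.prems(1)
  show ?case
  proof (cases "k \<le> card H")
    case False
    \<comment> \<open>Every list has more colours than \<open>H\<close> has vertices, so all
      vertices can receive different colours.\<close>
    obtain xs where xs: "set xs = H" "distinct xs" using finite_distinct_list[OF fin] by auto
    have "length xs \<le> card (L (xs ! i)) + i" if "i < length xs" for i
      using False less.prems(2)[of "xs ! i"] nth_mem[OF that] distinct_card[OF xs(2)] xs(1) by simp
    then obtain c where c: "inj_on c H" "\<forall>v\<in>H. c v \<in> L v"
      using greedy_transversal[OF xs(2), of L] xs(1) by auto
    have cls: "{v \<in> H. c v = a} = {} \<or> (\<exists>s\<in>H. {v \<in> H. c v = a} = {s})" for a
    proof (cases "\<exists>s\<in>H. c s = a")
      case True
      then obtain s where "s \<in> H" "c s = a" by blast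
      then have "{v \<in> H. c v = a} = {s}" using c(1) by (auto simp: inj_on_def)
      then show ?thesis using \<open>s \<in> H\<close> by blast
    qed blast
    have "forest_on N {s}" for s
      using forest_on_insert[OF forest_on_empty, of s N] irrefl by simp
    then have "forest_on N {v \<in> H. c v = a}" for a
      using cls[of a] forest_on_empty by metis
    moreover have "int (card {v \<in> H. c v = a}) \<le> \<lceil>real (card H) / real k\<rceil>" for a
    proof (cases "{v \<in> H. c v = a} = {}")
      case True
      have "0 \<le> real (card H) / real k" by simp
      then have "0 \<le> \<lceil>real (card H) / real k\<rceil>" by linarith
      then show ?thesis unfolding True by simp
    next
      case nonempty: False
      then have "card H > 0" using fin by (auto simp: card_gt_0_iff)
      then have "0 < real (card H) / real k" using \<open>k > 0\<close> by simp
      moreover have "card {v \<in> H. c v = a} = 1" using cls[of a] nonempty by auto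
      ultimately show ?thesis by simp
    qed
    ultimately show ?thesis using c(2) by blast
  next
    case True
    then obtain xs where xs: "distinct xs" "length xs = k" "set xs \<subseteq> H"
      and bound: "\<And>i. i < k \<Longrightarrow> card (N (xs ! i) \<inter> (H - set xs)) \<le> 2 * i + 1"
      using less.prems(3)[of H] by auto
    define U where "U = H - set xs"
    have cardU: "card H = card U + k"
      using xs fin card_mono[OF fin xs(3)] by (simp add: U_def card_Diff_subset distinct_card)
    have "U \<subseteq> H" by (auto simp: U_def)
    then have finU: "finite U" using fin finite_subset by auto
    have "\<exists>c. (\<forall>v\<in>U. c v \<in> L v) \<and> (\<forall>a. forest_on N {v \<in> U. c v = a} \<and>
      int (card {v \<in> U. c v = a}) \<le> \<lceil>real (card U) / real k\<rceil>)"
    proof (rule less.hyps)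
      show "card U < card H" using cardU \<open>k > 0\<close> by simp
      show "finite U" by fact
      show "finite (L v) \<and> card (L v) = k" if "v \<in> U" for v
        using less.prems(2) that \<open>U \<subseteq> H\<close> by blast
      show "\<exists>xs. distinct xs \<and> length xs = k \<and> set xs \<subseteq> W \<and>
        (\<forall>i<k. card (N (xs ! i) \<inter> (W - set xs)) \<le> 2 * i + 1)" if "W \<subseteq> U" "k \<le> card W" for W
        using less.prems(3) that \<open>U \<subseteq> H\<close> by (meson subset_trans)
    qed
    then obtain c where c: "\<And>v. v \<in> U \<Longrightarrow> c v \<in> L v" "\<And>a. forest_on N {v \<in> U. c v = a}"
      "\<And>a. int (card {v \<in> U. c v = a}) \<le> \<lceil>real (card U) / real k\<rceil>" by blast
    \<comment> \<open>Avoiding these colours leaves a new vertex at most one earlier neighbour in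
      its class; the other vertices of its round receive other colours.\<close>
    define bad where "bad x = {a \<in> L x. 2 \<le> card {v \<in> N x \<inter> U. c v = a}}" for x
    have "length xs \<le> card (L (xs ! i) - bad (xs ! i)) + i" if i: "i < length xs" for i
    proof -
      have "xs ! i \<in> H" using nth_mem[OF i] xs(3) by auto
      then have Lx: "finite (L (xs ! i))" "card (L (xs ! i)) = k" using less.prems(2) by auto
      then have "finite (bad (xs ! i))" by (simp add: bad_def)
      then have "2 * card (bad (xs ! i)) \<le> card (N (xs ! i) \<inter> U)"
        using finU by (intro card_repeated_colours[of _ _ c]) (auto simp: bad_def)
      also have "\<dots> \<le> 2 * i + 1" using bound i xs(2) by (simp add: U_def)
      \<comment> \<open>Halving absorbs the odd unit of \<open>2 * i + 1\<close>.\<close>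
      finally have "card (bad (xs ! i)) \<le> i" by linarith
      moreover have "card (L (xs ! i) - bad (xs ! i)) = k - card (bad (xs ! i))"
        using Lx \<open>finite (bad (xs ! i))\<close> by (subst card_Diff_subset) (auto simp: bad_def)
      ultimately show ?thesis using xs(2) by simp
    qed
    then have "\<exists>f. inj_on f (set xs) \<and> (\<forall>x\<in>set xs. f x \<in> L x - bad x)"
      using xs(1) by (intro greedy_transversal) auto
    then obtain f where f: "inj_on f (set xs)" "\<And>x. x \<in> set xs \<Longrightarrow> f x \<in> L x - bad x" by auto
    define c' where "c' v = (if v \<in> set xs then f v else c v)" for v
    have cls: "{v \<in> H. c' v = a} = {v \<in> U. c v = a} \<or>
      (\<exists>s\<in>set xs. f s = a \<and> {v \<in> H. c' v = a} = insert s {v \<in> U. c v = a})" for a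
    proof (cases "\<exists>s\<in>set xs. f s = a")
      case True
      then obtain s where "s \<in> set xs" "f s = a" by blast
      then have "{v \<in> H. c' v = a} = insert s {v \<in> U. c v = a}"
        using f(1) xs(3) by (auto simp: c'_def U_def inj_on_def)
      then show ?thesis using \<open>s \<in> set xs\<close> \<open>f s = a\<close> by blast
    next
      case False
      then have "{v \<in> H. c' v = a} = {v \<in> U. c v = a}" by (auto simp: c'_def U_def)
      then show ?thesis by blast
    qed
    have "forest_on N {v \<in> H. c' v = a}" for a
      using cls[of a]
    proof (elim disjE bexE conjE)
      fix s assume s: "s \<in> set xs" "f s = a" "{v \<in> H. c' v = a} = insert s {v \<in> U. c v = a}"
      have "f s \<notin> bad s" "f s \<in> L s" using f(2) s(1) by auto
      then have "card (N s \<inter> {v \<in> U. c v = a}) \<le> 1"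
        using s(2) by (auto simp: bad_def Int_def conj_assoc not_le)
      then show ?thesis
        unfolding s(3) using c(2) finU irrefl by (intro forest_on_insert) auto
    qed (simp add: c(2))
    moreover have "int (card {v \<in> H. c' v = a}) \<le> \<lceil>real (card H) / real k\<rceil>" for a
    proof -
      \<comment> \<open>The \<open>k\<close> new vertices raise the ceiling by exactly one, and
        injectivity of \<open>f\<close> adds at most one vertex to each class.\<close>
      have "real (card H) / real k = real (card U) / real k + 1"
        using cardU \<open>k > 0\<close> by (simp add: add_divide_distrib)
      moreover have "card {v \<in> H. c' v = a} \<le> card {v \<in> U. c v = a} + 1"
        using cls[of a] finU by (auto simp: card_insert_if)
      ultimately show ?thesis using c(3)[of a] by simp
    qed
    moreover have "\<forall>v\<in>H. c' v \<in> L v" using f(2) c(1) by (auto simp: c'_def U_def)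
    ultimately show ?thesis by blast
  qed
qed

lemma equitably_list_arborable_if_rounds:
  assumes G: "pair_graph G" and "k > 0"
    and rounds: "\<And>U. U \<subseteq> pverts G \<Longrightarrow> k \<le> card U \<Longrightarrow>
      \<exists>xs. distinct xs \<and> length xs = k \<and> set xs \<subseteq> U \<and>
        (\<forall>i<k. card (nbrs G (xs ! i) \<inter> (U - set xs)) \<le> 2 * i + 1)"
  shows "equitably_list_arborable TYPE('c) k G"
  unfolding equitably_list_arborable_def
proof (intro allI impI)
  interpret pair_graph G by fact
  fix L :: "'a \<Rightarrow> 'c set" assume L: "uniform_list_assignment G k L"
  have "\<exists>c. (\<forall>v\<in>pverts G. c v \<in> L v) \<and>
    (\<forall>a. forest_on (nbrs G) {v \<in> pverts G. c v = a} \<and>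
      int (card {v \<in> pverts G. c v = a}) \<le> \<lceil>real (card (pverts G)) / real k\<rceil>)"
    using L \<open>k > 0\<close> rounds
    by (intro equitable_forest_colouring)
      (auto simp: uniform_list_assignment_def nbrs_def dest: no_loops')
  then show "\<exists>c. list_colouring G L c \<and> equitable G k c \<and>
      (\<forall>a. acyclic_graph (with_proj G \<restriction> colour_class G c a))"
    using acyclic_graph_if_forest_on[OF G]
    unfolding list_colouring_def equitable_def colour_class_def by meson
qed

section \<open>Rounds in four-dimensional grids\<close>

type_synonym point = "nat \<times> nat \<times> nat \<times> nat"

text \<open>Distinct coefficients make steps comparable: going up by a cheap step and down by a
  dearer one lowers the weight, so it leads below a minimiser and out of the set.\<close>

fun weight :: "point \<Rightarrow> nat" where
  "weight (a, b, c, d) = 4 * a + 3 * b + 2 * c + d"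

fun step1 :: "point \<Rightarrow> point" where "step1 (a, b, c, d) = (Suc a, b, c, d)"
fun step2 :: "point \<Rightarrow> point" where "step2 (a, b, c, d) = (a, Suc b, c, d)"
fun step3 :: "point \<Rightarrow> point" where "step3 (a, b, c, d) = (a, b, Suc c, d)"
fun step4 :: "point \<Rightarrow> point" where "step4 (a, b, c, d) = (a, b, c, Suc d)"

definition up :: "point \<Rightarrow> point set" where
  "up v = {step1 v, step2 v, step3 v, step4 v}"

text \<open>Truncated subtraction may put \<open>(a, b, c, d)\<close> itself into this set; only upper bounds are used.\<close>

fun down :: "point \<Rightarrow> point set" where
  "down (a, b, c, d) = {(a - 1, b, c, d), (a, b - 1, c, d), (a, b, c - 1, d), (a, b, c, d - 1)}"

lemma finite_up: "finite (up v)" and card_up: "card (up v) \<le> 4"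
proof -
  have "up v = set [step1 v, step2 v, step3 v, step4 v]" by (simp add: up_def)
  then show "finite (up v)" "card (up v) \<le> 4"
    using card_length[of "[step1 v, step2 v, step3 v, step4 v]"] by simp_all
qed

lemma mem_down: "v \<in> up w \<Longrightarrow> w \<in> down v"
  by (cases w) (auto simp: up_def)

lemma finite_down: "finite (down v)"
  by (cases v) simp

lemma card_down: "card (down v) \<le> 4"
proof (cases v)
  case (fields a b c d)
  then show ?thesis
    using card_length[of "[(a - 1, b, c, d), (a, b - 1, c, d), (a, b, c - 1, d), (a, b, c, d - 1)]"]
    by simp
qed

lemma weight_up: "v \<in> up w \<Longrightarrow> weight w < weight v"
  by (cases w) (auto simp: up_def)

text \<open>One implication suffices because only upper bounds on degrees are needed; the boundary
  of the grid can only remove neighbours.\<close>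

locale grid_nbrs =
  fixes N :: "point \<Rightarrow> point set"
  assumes nbr_cases: "w \<in> N v \<Longrightarrow> w \<in> up v \<or> v \<in> up w"
begin

text \<open>Inserting \<open>x\<close> prepares the bound 7 after its removal, whether or not
  \<open>x\<close> belongs to \<open>N v\<close>.\<close>

lemma card_nbrs_insert: "card (insert x (N v)) \<le> 8" if "x \<in> down v"
proof -
  have "insert x (N v) \<subseteq> up v \<union> down v" using nbr_cases mem_down that by blast
  then have "card (insert x (N v)) \<le> card (up v \<union> down v)"
    by (intro card_mono) (simp_all add: finite_up finite_down)
  also have "\<dots> \<le> 8" using card_Un_le[of "up v" "down v"] card_up[of v] card_down[of v] by simp
  finally show ?thesis .
qed

lemma finite_nbrs: "finite (N v)"
proof (rule finite_subset)
  show "N v \<subseteq> up v \<union> down v" using nbr_cases mem_down by blast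
qed (simp add: finite_up finite_down)

lemma card_nbrs: "card (N v \<inter> X) \<le> 8"
proof -
  obtain x where "x \<in> down v" by (cases v) auto
  have "card (N v \<inter> X) \<le> card (insert x (N v))"
    by (intro card_mono) (auto simp: finite_nbrs)
  then show ?thesis using card_nbrs_insert[OF \<open>x \<in> down v\<close>] by simp
qed

section \<open>Degrees near a vertex of minimal weight\<close>

lemma card_nbrs_mono: "card (N v \<inter> X) \<le> n" if "N v \<inter> X \<subseteq> Y" "finite Y" "card Y \<le> n"
  using card_mono[OF that(2,1)] that(3) by simp

text \<open>A neighbour below a minimiser of the weight would be lighter.\<close>

lemma exists_few_nbrs:
  assumes "finite X" "X \<noteq> {}"
  shows "\<exists>x\<in>X. (\<forall>y\<in>X. weight x \<le> weight y) \<and> N x \<inter> X \<subseteq> up x"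
proof -
  obtain x where x: "x \<in> X" "\<forall>y\<in>X. weight x \<le> weight y"
    using ex_is_arg_min_if_finite[OF assms, of weight] unfolding is_arg_min_linorder by blast
  moreover have "N x \<inter> X \<subseteq> up x"
  proof
    fix y assume y: "y \<in> N x \<inter> X"
    then have "\<not> x \<in> up y" using x(2) weight_up[of x y] by (auto simp: not_less[symmetric])
    then show "y \<in> up x" using nbr_cases y by blast
  qed
  ultimately show ?thesis by blast
qed

text \<open>Any step down from \<open>step4 x\<close> other than back to \<open>x\<close> costs at
  least 2 and lands below the weight of \<open>x\<close>, hence outside \<open>X\<close>.\<close>

lemma card_nbrs_above:
  assumes min: "\<And>y. y \<in> X \<Longrightarrow> weight x \<le> weight y"
  shows "u \<in> up x \<Longrightarrow> card (N u \<inter> (X - {x})) \<le> 7"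
    and "card (N (step4 x) \<inter> (X - {x})) \<le> 4"
    and "card (N (step3 x) \<inter> (X - {x})) \<le> 5"
proof -
  show "card (N u \<inter> (X - {x})) \<le> 7" if "u \<in> up x"
  proof -
    have "card (N u \<inter> (X - {x})) \<le> card (insert x (N u) - {x})"
      by (intro card_mono) (auto simp: finite_nbrs)
    also have "\<dots> = card (insert x (N u)) - 1"
      using finite_nbrs by (subst card_Diff_singleton) auto
    also have "\<dots> \<le> 7" using card_nbrs_insert[OF mem_down[OF that]] by simp
    finally show ?thesis .
  qed
  obtain a b c d where x: "x = (a, b, c, d)" by (cases x)
  have "y \<in> up (step4 x)" if "y \<in> N (step4 x) \<inter> (X - {x})" for y
    using nbr_cases[of y "step4 x"] min[of y] that x by (cases y) (auto simp: up_def)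
  then have "N (step4 x) \<inter> (X - {x}) \<subseteq> up (step4 x)" by blast
  then show "card (N (step4 x) \<inter> (X - {x})) \<le> 4"
    by (rule card_nbrs_mono) (simp_all add: finite_up card_up)
  \<comment> \<open>From \<open>step3 x\<close>, only a step down in the last coordinate stays above
    the weight of \<open>x\<close>.\<close>
  have "y \<in> insert (a, b, Suc c, d - 1) (up (step3 x))" if "y \<in> N (step3 x) \<inter> (X - {x})" for y
    using nbr_cases[of y "step3 x"] min[of y] that x by (cases y) (auto simp: up_def)
  then have "N (step3 x) \<inter> (X - {x}) \<subseteq> insert (a, b, Suc c, d - 1) (up (step3 x))" by blast
  then show "card (N (step3 x) \<inter> (X - {x})) \<le> 5"
    by (rule card_nbrs_mono) (use card_up[of "step3 x"] in \<open>auto simp: finite_up card_insert_if\<close>)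
qed

text \<open>A remaining neighbour of \<open>v\<close> is taken as \<open>y\<close> if there is one;
  otherwise any remaining vertex will do.\<close>

lemma exists_fifth:
  assumes "finite H" "T \<subseteq> H" "card T < card H" "card (N v \<inter> (H - T)) \<le> 4"
  shows "\<exists>y\<in>H - T. card (N v \<inter> (H - insert y T)) \<le> 3"
proof (cases "N v \<inter> (H - T) = {}")
  case True
  obtain y where "y \<in> H - T" using assms(1-3) by (metis DiffI less_irrefl subsetI subset_antisym)
  moreover have "N v \<inter> (H - insert y T) = {}" using True by auto
  ultimately show ?thesis by (intro bexI[of _ y]) simp_all
next
  case False
  then obtain y where y: "y \<in> N v \<inter> (H - T)" by blast
  have "N v \<inter> (H - insert y T) = N v \<inter> (H - T) - {y}" by auto
  then have "card (N v \<inter> (H - insert y T)) = card (N v \<inter> (H - T)) - 1"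
    using y by (simp add: card_Diff_singleton)
  then show ?thesis using y assms(4) by (intro bexI[of _ y]) auto
qed

section \<open>The first four vertices and the whole round\<close>

lemma card_nbrs_Diff_mono:
  "card (N v \<inter> (H - S)) \<le> n" if "card (N v \<inter> (H - T)) \<le> n" "T \<subseteq> S"
proof -
  have "card (N v \<inter> (H - S)) \<le> card (N v \<inter> (H - T))"
    using that(2) finite_nbrs by (intro card_mono) auto
  then show ?thesis using that(1) by simp
qed

text \<open>
  The vertex \<open>x\<close> minimises the weight. If \<open>x\<close> has at most two neighbours in \<open>H\<close>, one of them and the next
  two minimisers complete it, because a minimiser has at most four neighbours left. Otherwise two
  neighbours \<open>f\<close>, \<open>g\<close> are needed; then \<open>f\<close> can be chosen as \<open>step3 x\<close> or \<open>step4 x\<close>, which have at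
  most five neighbours left. A neighbour of \<open>x\<^sub>2\<close> as fifth vertex of the round will lower its four to three.
\<close>

lemma exists_first_four:
  assumes fin: "finite H" and five: "5 \<le> card H"
  shows "\<exists>x1 x2 x3 x4. distinct [x1, x2, x3, x4] \<and> {x1, x2, x3, x4} \<subseteq> H \<and>
    card (N x1 \<inter> (H - {x1, x2, x3, x4})) \<le> 1 \<and>
    card (N x2 \<inter> (H - {x1, x2, x3, x4})) \<le> 4 \<and>
    card (N x3 \<inter> (H - {x1, x2, x3, x4})) \<le> 5 \<and>
    card (N x4 \<inter> (H - {x1, x2, x3, x4})) \<le> 7"
proof -
  \<comment> \<open>Fewer than five removals leave \<open>H\<close> nonempty, and a minimiser of the
    rest has only its four upper neighbours.\<close>
  have ex_min: "\<exists>z\<in>H - set zs. card (N z \<inter> (H - set zs)) \<le> 4" if "length zs < 5" for zs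
  proof -
    have "H - set zs \<noteq> {}"
      using that five card_mono[OF finite_set, of H zs] card_length[of zs] by auto
    then obtain z where "z \<in> H - set zs" "N z \<inter> (H - set zs) \<subseteq> up z"
      using exists_few_nbrs[of "H - set zs"] fin by auto
    then show ?thesis using card_nbrs_mono[OF _ finite_up card_up] by blast
  qed
  have "H \<noteq> {}" using five by auto
  then obtain x where x: "x \<in> H" and min: "\<And>y. y \<in> H \<Longrightarrow> weight x \<le> weight y"
    and upx: "N x \<inter> H \<subseteq> up x" using exists_few_nbrs[OF fin] by blast
  note above = card_nbrs_above[of H x, OF min]
  have x_notin: "x \<notin> N x \<inter> H" using upx weight_up[of x x] by auto
  have finD: "finite (N x \<inter> H)" using fin by simp
  have mono1: "card (N x \<inter> (H - S)) \<le> 1" if "card (N x \<inter> H - T) \<le> 1" "T \<subseteq> S" for S T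
  proof -
    have "card (N x \<inter> (H - S)) \<le> card (N x \<inter> H - T)"
      using that(2) finD by (intro card_mono) auto
    then show ?thesis using that(1) by simp
  qed
  show ?thesis
  proof (cases "card (N x \<inter> H) \<le> 2")
    case True
    have "\<exists>f\<in>H - {x}. card (N f \<inter> (H - {x})) \<le> 7 \<and> card (N x \<inter> H - {f}) \<le> 1"
    proof (cases "card (N x \<inter> H) \<le> 1")
      case True
      obtain f where "f \<in> H - {x}" "card (N f \<inter> (H - {x})) \<le> 4" using ex_min[of "[x]"] by auto
      moreover have "card (N x \<inter> H - {f}) \<le> 1"
        using True card_mono[OF finD Diff_subset, of "{f}"] by simp
      ultimately show ?thesis by (intro bexI[of _ f]) auto
    next
      case False
      then have "N x \<inter> H \<noteq> {}" by (metis card.empty zero_le)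
      then obtain f where f: "f \<in> N x \<inter> H" by blast
      then have "card (N x \<inter> H - {f}) \<le> 1" using True by (simp add: card_Diff_singleton)
      moreover have "card (N f \<inter> (H - {x})) \<le> 7" using above(1)[of f] f upx by auto
      moreover have "f \<noteq> x" using f x_notin by auto
      ultimately show ?thesis using f by (intro bexI[of _ f]) auto
    qed
    then obtain f where f: "f \<in> H" "f \<noteq> x" "card (N f \<inter> (H - {x})) \<le> 7"
      "card (N x \<inter> H - {f}) \<le> 1" by auto
    obtain x2 where x2: "x2 \<in> H - {x, f}" "card (N x2 \<inter> (H - {x, f})) \<le> 4"
      using ex_min[of "[x, f]"] by auto
    obtain x3 where x3: "x3 \<in> H - {x, f, x2}" "card (N x3 \<inter> (H - {x, f, x2})) \<le> 4"
      using ex_min[of "[x, f, x2]"] by auto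
    have "card (N x3 \<inter> (H - {x, x2, x3, f})) \<le> 4"
      by (rule card_nbrs_Diff_mono[OF x3(2)]) auto
    then show ?thesis
      using x f x2 x3 mono1[OF f(4), of "{x, x2, x3, f}"]
        card_nbrs_Diff_mono[OF x2(2), of "{x, x2, x3, f}"]
        card_nbrs_Diff_mono[OF f(3), of "{x, x2, x3, f}"]
      by (intro exI[of _ x] exI[of _ x2] exI[of _ x3] exI[of _ f]) auto
  next
    case False
    define u where "u = step4 x"
    have sub: "N x \<inter> H \<subseteq> {step1 x, step2 x, step3 x, u}" using upx by (simp add: up_def u_def)
    \<comment> \<open>As \<open>x\<close> has at least three of its four upper neighbours in
      \<open>H\<close>, \<open>step3 x\<close> or \<open>step4 x\<close> is among them.\<close>
    define f where "f = (if step3 x \<in> N x \<inter> H then step3 x else u)"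
    have "u \<in> N x \<inter> H" if "step3 x \<notin> N x \<inter> H"
    proof (rule ccontr)
      assume "u \<notin> N x \<inter> H"
      then have "N x \<inter> H \<subseteq> set [step1 x, step2 x]" using that sub by auto
      then have "card (N x \<inter> H) \<le> card (set [step1 x, step2 x])" by (intro card_mono) auto
      also have "\<dots> \<le> 2" using card_length[of "[step1 x, step2 x]"] by simp
      finally show False using False by simp
    qed
    then have f: "f \<in> N x \<inter> H" by (simp add: f_def)
    have f5: "card (N f \<inter> (H - {x})) \<le> 5" using above(2,3) by (simp add: f_def u_def)
    have "\<not> N x \<inter> H \<subseteq> {f, u}"
    proof
      assume "N x \<inter> H \<subseteq> {f, u}"
      then have "card (N x \<inter> H) \<le> card {f, u}" by (intro card_mono) auto
      also have "\<dots> \<le> 2" using card_length[of "[f, u]"] by simp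
      finally show False using False by simp
    qed
    \<comment> \<open>Excluding \<open>u\<close> as well keeps it free to serve as
      \<open>x2\<close>.\<close>
    then obtain g where g: "g \<in> N x \<inter> H" "g \<noteq> f" "g \<noteq> u" by blast
    have g7: "card (N g \<inter> (H - {x})) \<le> 7" using above(1)[of g] g upx by auto
    have ne: "f \<noteq> x" "g \<noteq> x" using f g x_notin by auto
    \<comment> \<open>If \<open>u\<close> is a further neighbour of \<open>x\<close>, it becomes
      \<open>x2\<close>, and at most one of four neighbours is left. Otherwise \<open>x\<close> has
      at most three neighbours, \<open>f\<close> and \<open>g\<close> suffice, and \<open>x2\<close>
      is a minimiser of the rest.\<close>
    have "\<exists>x2\<in>H - {x, f, g}. card (N x2 \<inter> (H - {x, f, g})) \<le> 4 \<and> card (N x \<inter> H - {f, g, x2}) \<le> 1"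
    proof (cases "u \<in> N x \<inter> H \<and> u \<noteq> f")
      case True
      have "card {step1 x, step2 x, step3 x, u} \<le> 4"
        using card_up[of x] by (simp add: up_def u_def)
      then have "card (N x \<inter> H) \<le> 4" using card_mono[OF _ sub] by simp
      then have "card (N x \<inter> H - {f, g, u}) \<le> 1"
        using True f g by (subst card_Diff_subset) auto
      moreover have "card (N u \<inter> (H - {x, f, g})) \<le> 4"
        using above(2) unfolding u_def by (rule card_nbrs_Diff_mono) auto
      moreover have "u \<noteq> x" using True x_notin by auto
      ultimately show ?thesis using True g by (intro bexI[of _ u]) auto
    next
      case no_u: False
      obtain x2 where x2: "x2 \<in> H - {x, f, g}" "card (N x2 \<inter> (H - {x, f, g})) \<le> 4"
        using ex_min[of "[x, f, g]"] by auto
      have "N x \<inter> H \<subseteq> set [step1 x, step2 x, f]"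
        using no_u sub by (auto simp: f_def split: if_splits)
      then have "card (N x \<inter> H) \<le> card (set [step1 x, step2 x, f])" by (intro card_mono) auto
      also have "\<dots> \<le> 3" using card_length[of "[step1 x, step2 x, f]"] by simp
      finally have "card (N x \<inter> H - {f, g}) \<le> 1" using f g by (subst card_Diff_subset) auto
      moreover have "card (N x \<inter> H - {f, g, x2}) \<le> card (N x \<inter> H - {f, g})"
        using finD by (intro card_mono) auto
      ultimately show ?thesis using x2 by (intro bexI[of _ x2]) auto
    qed
    then obtain x2 where x2: "x2 \<in> H - {x, f, g}" "card (N x2 \<inter> (H - {x, f, g})) \<le> 4"
      "card (N x \<inter> H - {f, g, x2}) \<le> 1" by blast
    then show ?thesis
      using x f g ne mono1[OF x2(3), of "{x, x2, f, g}"]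
        card_nbrs_Diff_mono[OF x2(2), of "{x, x2, f, g}"]
        card_nbrs_Diff_mono[OF f5, of "{x, x2, f, g}"]
        card_nbrs_Diff_mono[OF g7, of "{x, x2, f, g}"]
      by (intro exI[of _ x] exI[of _ x2] exI[of _ f] exI[of _ g]) auto
  qed
qed

text \<open>From index 4 on the bound is at least 9 and exceeds every degree, so the fifth vertex
  can be spent on lowering the count of \<open>x2\<close> from 4 to 3 and the rest is arbitrary.
  This is where \<open>5 \<le> k\<close> enters.\<close>

lemma exists_round:
  assumes fin: "finite H" and k: "5 \<le> k" "k \<le> card H"
  shows "\<exists>xs. distinct xs \<and> length xs = k \<and> set xs \<subseteq> H \<and>
    (\<forall>i<k. card (N (xs ! i) \<inter> (H - set xs)) \<le> 2 * i + 1)"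
proof -
  obtain x1 x2 x3 x4 where x: "distinct [x1, x2, x3, x4]" "{x1, x2, x3, x4} \<subseteq> H"
    and b: "card (N x1 \<inter> (H - {x1, x2, x3, x4})) \<le> 1"
      "card (N x2 \<inter> (H - {x1, x2, x3, x4})) \<le> 4"
      "card (N x3 \<inter> (H - {x1, x2, x3, x4})) \<le> 5"
      "card (N x4 \<inter> (H - {x1, x2, x3, x4})) \<le> 7"
    using exists_first_four[OF fin le_trans[OF k]] by (elim exE conjE) (rule that)
  have card4: "card {x1, x2, x3, x4} = 4" using x(1) by simp
  obtain y where y: "y \<in> H - {x1, x2, x3, x4}"
    "card (N x2 \<inter> (H - insert y {x1, x2, x3, x4})) \<le> 3"
  proof -
    have "card {x1, x2, x3, x4} < card H" using card4 k by linarith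
    then show ?thesis using exists_fifth[OF fin x(2) _ b(2)] that by blast
  qed
  let ?T = "insert y {x1, x2, x3, x4}"
  have "card ?T = 5" "?T \<subseteq> H" using y(1) card4 x(2) by auto
  then have "k - 5 \<le> card (H - ?T)" using k by (subst card_Diff_subset) auto
  then obtain R where R: "R \<subseteq> H - ?T" "card R = k - 5" "finite R"
    using obtain_subset_with_card_n by blast
  then obtain rs where rs: "set rs = R" "distinct rs" using finite_distinct_list by blast
  let ?xs = "[x1, x2, x3, x4, y] @ rs"
  have len: "length ?xs = k" using rs R(2) k distinct_card[OF rs(2)] by simp
  have "card (N (?xs ! i) \<inter> (H - set ?xs)) \<le> 2 * i + 1" for i
  proof -
    consider "i = 0" | "i = 1" | "i = 2" | "i = 3" | "4 \<le> i" by linarith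
    then show ?thesis
    proof cases
      case 1
      then show ?thesis using card_nbrs_Diff_mono[OF b(1), of "set ?xs"] by auto
    next
      case 2
      then show ?thesis using card_nbrs_Diff_mono[OF y(2), of "set ?xs"] by auto
    next
      case 3
      then show ?thesis using card_nbrs_Diff_mono[OF b(3), of "set ?xs"] by auto
    next
      case 4
      then show ?thesis using card_nbrs_Diff_mono[OF b(4), of "set ?xs"]
        by (auto simp: numeral_3_eq_3)
    next
      case 5
      then show ?thesis using card_nbrs[of "?xs ! i" "H - set ?xs"] by linarith
    qed
  qed
  moreover have "distinct ?xs" "set ?xs \<subseteq> H" using x y(1) R(1) rs by auto
  ultimately show ?thesis using len by blast
qed

end

theorem theorem13:
  fixes k n1 n2 n3 n4 :: nat
  assumes "k \<ge> 5"
    and "n1 \<ge> 2" and "n2 \<ge> 2" and "n3 \<ge> 2" and "n4 \<ge> 2"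
  shows "equitably_list_arborable TYPE('c) k
    (path_graph n1 \<box> path_graph n2 \<box> path_graph n3 \<box> path_graph n4)"
proof -
  let ?G = "path_graph n1 \<box> path_graph n2 \<box> path_graph n3 \<box> path_graph n4"
  have G: "pair_graph ?G"
    by (intro pair_graph_cartesian_product pair_graph_path_graph)
  interpret G: pair_graph ?G by (rule G)
  \<comment> \<open>The product associates to the right, so its vertices are of type
    \<open>point\<close>; an arc changes one coordinate by one.\<close>
  interpret grid_nbrs "nbrs ?G"
  proof
    show "w \<in> up v \<or> v \<in> up w" if "w \<in> nbrs ?G v" for v w
      using that by (cases v; cases w)
        (simp add: nbrs_def up_def cartesian_product_def path_graph_def, elim disjE conjE; simp)
  qed
  show ?thesis
  proof (rule equitably_list_arborable_if_rounds[OF G])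
    show "k > 0" using assms(1) by simp
    show "\<exists>xs. distinct xs \<and> length xs = k \<and> set xs \<subseteq> U \<and>
        (\<forall>i<k. card (nbrs ?G (xs ! i) \<inter> (U - set xs)) \<le> 2 * i + 1)"
      if "U \<subseteq> pverts ?G" "k \<le> card U" for U
      using exists_round[of U k] assms(1) that finite_subset[OF that(1)] by simp
  qed
qed

end
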